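(* Let $G$ be a locally compact group. There is a one-to-one correspondence between closed subgroups $H$ of $G$ and strictly closed, left invariant C*-subalgebras $X$ of $C_b(G)$, given by \[ X = \{ f\in C_b(G) : R_s f = f \text{ for every } s\in H\}, \] \[ H = \{ s\in G : R_s f = f \text{ for every } f\in X\}. \] That is, the first formula assigns to each closed subgroup $H$ of $G$ a strictly closed, left invariant C*-subalgebra $X$ of $C_b(G)$, the second formula assigns to each strictly closed, left invariant C*-subalgebra $X$ of $C_b(G)$ a closed subgroup $H$ of $G$, and these two assignments are inverse to each other. Moreover, $H$ is normal if and only if the corresponding $X$ is right invariant.
   Context: $C_b(G)$ is the C*-algebra of bounded continuous functions $G\to\mathbb{C}$ (with pointwise operations and the supremum norm), identified with the multiplier algebra of the C*-algebra $C_0(G)$ of continuous functions vanishing at infinity. The strict topology on the multiplier algebra $M(A)$ of a C*-algebra $A$ is the topology generated by the seminorms $x\mapsto \|xa\|$ and $x\mapsto\|ax\|$, where $a$ runs through $A$; thus on $C_b(G)$ it is generated by the seminorms $f\mapsto \|fg\|_\infty$, $g\in C_0(G)$. "Strictly closed" means closed in the strict topology. For $s,t\in G$ and $f\colon G\to\mathbb{C}$, the left and right translations are $L_s f(t)=f(st)$ and $R_s f(t)=f(ts)$. A subset $X\subseteq C_b(G)$ is left invariant if $L_s f\in X$ for all $f\in X$, $s\in G$, and right invariant if $R_s f\in X$ for all $f\in X$, $s\in G$.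
   Formalization: The C*-subalgebras X are required to be nonzero: X = {0} is strictly closed and left invariant, but its H is all of G, whose associated algebra is the constant functions, not {0}. *)

theory Defs
  imports "HOL-Analysis.Analysis" "HOL-Algebra.Coset"
begin

text \<open>The group structure lives on all of a Hausdorff topological space. Since the space is an
  arbitrary type of class \<^class>\<open>t2_space\<close>, this is no loss of generality.\<close>

locale locally_compact_group = group G
  for G :: "('a::t2_space, 'b) monoid_scheme" (structure) +
  assumes carrier_UNIV: "carrier G = UNIV"
    and continuous_mult: "continuous_on UNIV (\<lambda>(x, y). x \<otimes> y)"
    and continuous_inv: "continuous_on UNIV (\<lambda>x. inv x)"
    and locally_compact: "locally_compact_space (euclidean :: 'a topology)"

definition left_translate :: "('a, 'b) monoid_scheme \<Rightarrow> 'a \<Rightarrow> ('a \<Rightarrow> complex) \<Rightarrow> 'a \<Rightarrow> complex"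
  where "left_translate G s f = (\<lambda>t. f (s \<otimes>\<^bsub>G\<^esub> t))"

definition right_translate :: "('a, 'b) monoid_scheme \<Rightarrow> 'a \<Rightarrow> ('a \<Rightarrow> complex) \<Rightarrow> 'a \<Rightarrow> complex"
  where "right_translate G s f = (\<lambda>t. f (t \<otimes>\<^bsub>G\<^esub> s))"

text \<open>The C*-algebra of bounded continuous functions is the Banach space \<open>'a \<Rightarrow>\<^sub>C complex\<close> (its norm
  is the supremum norm) with the following pointwise operations.\<close>

unbundle bcontfun.lifting

lift_definition bc_mult ::
    "('a::topological_space \<Rightarrow>\<^sub>C complex) \<Rightarrow> ('a \<Rightarrow>\<^sub>C complex) \<Rightarrow> 'a \<Rightarrow>\<^sub>C complex"
  is "\<lambda>f g x. f x * g x"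
proof -
  fix f g :: "'a \<Rightarrow> complex"
  assume f: "f \<in> bcontfun" and g: "g \<in> bcontfun"
  obtain B C where "\<And>x. norm (f x) \<le> B" "\<And>x. norm (g x) \<le> C"
    using f g by (auto simp: bcontfun_def bounded_iff)
  then have "norm (f x * g x) \<le> B * C" for x
    unfolding norm_mult by (meson mult_mono norm_ge_zero order_trans)
  then show "(\<lambda>x. f x * g x) \<in> bcontfun"
    using f g by (auto simp: bcontfun_def bounded_iff intro!: continuous_intros)
qed

lift_definition bc_cnj :: "('a::topological_space \<Rightarrow>\<^sub>C complex) \<Rightarrow> 'a \<Rightarrow>\<^sub>C complex"
  is "\<lambda>f x. cnj (f x)"
  by (auto simp: bcontfun_def bounded_iff intro!: continuous_intros)

definition bc_scale :: "complex \<Rightarrow> ('a::topological_space \<Rightarrow>\<^sub>C complex) \<Rightarrow> 'a \<Rightarrow>\<^sub>C complex"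
  where "bc_scale c f = bc_mult (const_bcontfun c) f"

definition cstar_subalgebra :: "('a::topological_space \<Rightarrow>\<^sub>C complex) set \<Rightarrow> bool"
  where "cstar_subalgebra X \<longleftrightarrow>
    0 \<in> X \<and>
    (\<forall>f\<in>X. \<forall>g\<in>X. f + g \<in> X) \<and>
    (\<forall>c. \<forall>f\<in>X. bc_scale c f \<in> X) \<and>
    (\<forall>f\<in>X. \<forall>g\<in>X. bc_mult f g \<in> X) \<and>
    (\<forall>f\<in>X. bc_cnj f \<in> X) \<and>
    closed X"

definition C0 :: "('a::topological_space \<Rightarrow>\<^sub>C complex) set"
  where "C0 = {g. \<forall>\<epsilon>>0. \<exists>K. compact K \<and> (\<forall>x. x \<notin> K \<longrightarrow> norm (apply_bcontfun g x) < \<epsilon>)}"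

definition seminorm_topology :: "('v::ab_group_add \<Rightarrow> real) set \<Rightarrow> 'v topology"
  where "seminorm_topology P =
    topology_generated_by {{x. p (x - x0) < r} | p x0 r. p \<in> P \<and> r > 0}"

definition strict_topology :: "('a::topological_space \<Rightarrow>\<^sub>C complex) topology"
  where "strict_topology = seminorm_topology ((\<lambda>g f. norm (bc_mult f g)) ` C0)"

text \<open>Translates are functions \<open>'a \<Rightarrow> complex\<close>, so membership in \<open>X\<close> is expressed through the
  embedding \<^const>\<open>apply_bcontfun\<close>.\<close>

definition left_invariant ::
    "('a::topological_space, 'b) monoid_scheme \<Rightarrow> ('a \<Rightarrow>\<^sub>C complex) set \<Rightarrow> bool"
  where "left_invariant G X \<longleftrightarrow>
    (\<forall>f\<in>X. \<forall>s\<in>carrier G. left_translate G s (apply_bcontfun f) \<in> apply_bcontfun ` X)"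

definition right_invariant ::
    "('a::topological_space, 'b) monoid_scheme \<Rightarrow> ('a \<Rightarrow>\<^sub>C complex) set \<Rightarrow> bool"
  where "right_invariant G X \<longleftrightarrow>
    (\<forall>f\<in>X. \<forall>s\<in>carrier G. right_translate G s (apply_bcontfun f) \<in> apply_bcontfun ` X)"

definition closed_subgroups :: "('a::topological_space, 'b) monoid_scheme \<Rightarrow> 'a set set"
  where "closed_subgroups G = {H. subgroup H G \<and> closed H}"

text \<open>The zero algebra is excluded: it is strictly closed and left invariant, but its right
  stabilizer is the whole group, whose fixed-point algebra consists of the constants.\<close>

definition left_invariant_algebras ::
    "('a::topological_space, 'b) monoid_scheme \<Rightarrow> ('a \<Rightarrow>\<^sub>C complex) set set"
  where "left_invariant_algebras G =
    {X. cstar_subalgebra X \<and> X \<noteq> {0} \<and> closedin strict_topology X \<and> left_invariant G X}"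

definition fixed_algebra ::
    "('a::topological_space, 'b) monoid_scheme \<Rightarrow> 'a set \<Rightarrow> ('a \<Rightarrow>\<^sub>C complex) set"
  where "fixed_algebra G H =
    {f. \<forall>s\<in>H. right_translate G s (apply_bcontfun f) = apply_bcontfun f}"

definition right_stabilizer ::
    "('a::topological_space, 'b) monoid_scheme \<Rightarrow> ('a \<Rightarrow>\<^sub>C complex) set \<Rightarrow> 'a set"
  where "right_stabilizer G X =
    {s \<in> carrier G. \<forall>f\<in>X. right_translate G s (apply_bcontfun f) = apply_bcontfun f}"

end

theory Submission
  imports Defs
begin

text \<open>Let \<open>H\<close> be the right stabilizer of \<open>X\<close>. By left invariance, two points \<open>s\<close>, \<open>t\<close> that \<open>X\<close>
  fails to separate satisfy \<open>inv s \<otimes> t \<in> H\<close>, and \<open>X\<close> vanishes at no point because it is nonzero.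
  So an \<open>H\<close>-fixed function can be approximated on compact sets by elements of \<open>X\<close>
  (Stone--Weierstrass), and functional calculus in the norm-closed algebra \<open>X\<close> keeps the
  approximants uniformly bounded, which makes the approximation strict. Conversely, a closed
  subgroup \<open>H\<close> is recovered from its fixed algebra because the locally compact Hausdorff space
  \<open>G/H\<close> is completely regular.\<close>

section \<open>Uniformly closed algebras of real functions\<close>

text \<open>The constants are not assumed to lie in \<open>A\<close>: a strictly closed subalgebra
  is not known in advance to be unital. This is why only functions fixing 0 are composed with
  elements of \<open>A\<close> below.\<close>

locale uniform_algebra =
  fixes A :: "('a::topological_space \<Rightarrow> real) set"
  assumes continuous: "u \<in> A \<Longrightarrow> continuous_on UNIV u"
    and bounded: "u \<in> A \<Longrightarrow> \<exists>M. \<forall>x. \<bar>u x\<bar> \<le> M"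
    and zero_mem: "(\<lambda>x. 0) \<in> A"
    and add_mem: "u \<in> A \<Longrightarrow> v \<in> A \<Longrightarrow> (\<lambda>x. u x + v x) \<in> A"
    and scale_mem: "u \<in> A \<Longrightarrow> (\<lambda>x. c * u x) \<in> A"
    and mult_mem: "u \<in> A \<Longrightarrow> v \<in> A \<Longrightarrow> (\<lambda>x. u x * v x) \<in> A"
    and uniform_limit: "(\<And>e. e > 0 \<Longrightarrow> \<exists>v\<in>A. \<forall>x. \<bar>v x - u x\<bar> \<le> e) \<Longrightarrow> u \<in> A"
begin

lemma diff_mem: "u \<in> A \<Longrightarrow> v \<in> A \<Longrightarrow> (\<lambda>x. u x - v x) \<in> A"
  using add_mem[OF _ scale_mem[of v "-1"]] by simp

section \<open>Functional calculus and lattice operations\<close>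

text \<open>Subtracting \<open>p 0\<close> removes the constant term, which might lead out of
  \<open>A\<close>.\<close>

lemma polynomial:
  fixes p :: "real \<Rightarrow> real"
  assumes "real_polynomial_function p" "u \<in> A"
  shows "(\<lambda>x. p (u x) - p 0) \<in> A"
  using assms(1)
proof induction
  case (linear f)
  then have "f (u x) = f 1 * u x" for x
    using linear_scale[of f "u x" 1] by (simp add: bounded_linear.linear)
  moreover have "f 0 = 0"
    using linear by (simp add: linear_simps)
  ultimately show ?case
    using scale_mem[OF assms(2)] by simp
next
  case (const c)
  then show ?case by (simp add: zero_mem)
next
  case (add f g)
  have "(\<lambda>x. (f (u x) - f 0) + (g (u x) - g 0)) \<in> A"
    by (rule add_mem; rule add.IH)
  then show ?case by (simp add: algebra_simps)
next
  case (mult f g)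
  \<comment> \<open>The increment of a product, expanded in the increments of its factors; each
    summand contains an increment and so stays in \<open>A\<close>.\<close>
  have "(\<lambda>x. ((f (u x) - f 0) * (g (u x) - g 0) + g 0 * (f (u x) - f 0)) + f 0 * (g (u x) - g 0)) \<in> A"
    by (intro add_mem mult_mem scale_mem mult.IH)
  then show ?case by (simp add: algebra_simps)
qed

text \<open>Weierstrass approximates \<open>\<phi>\<close> by a polynomial on an interval containing
  the range of \<open>u\<close>. As \<open>\<phi> 0 = 0\<close>, dropping the constant term costs
  only a second \<open>e / 2\<close>.\<close>

lemma compose:
  fixes \<phi> :: "real \<Rightarrow> real"
  assumes "continuous_on UNIV \<phi>" "\<phi> 0 = 0" "u \<in> A"
  shows "(\<lambda>x. \<phi> (u x)) \<in> A"
proof (rule uniform_limit)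
  fix e :: real
  assume "e > 0"
  obtain M where M: "\<And>x. \<bar>u x\<bar> \<le> M"
    using bounded[OF assms(3)] by blast
  obtain p where p: "real_polynomial_function p" "\<And>y. y \<in> {-M..M} \<Longrightarrow> \<bar>\<phi> y - p y\<bar> < e / 2"
    using Stone_Weierstrass_real_polynomial_function[of "{-M..M}" \<phi> "e / 2"] assms(1) \<open>e > 0\<close>
    by (metis compact_Icc continuous_on_subset half_gt_zero subset_UNIV)
  have "0 \<in> {-M..M}"
    using M[of undefined] by auto
  then have p0: "\<bar>p 0\<bar> < e / 2"
    using p(2)[of 0] assms(2) by simp
  have "\<bar>(p (u x) - p 0) - \<phi> (u x)\<bar> \<le> e" for x
  proof -
    have "\<bar>\<phi> (u x) - p (u x)\<bar> < e / 2"
      using p(2)[of "u x"] M[of x] by (simp add: abs_le_iff)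
    then show ?thesis using p0 by linarith
  qed
  then show "\<exists>v\<in>A. \<forall>x. \<bar>v x - \<phi> (u x)\<bar> \<le> e"
    using polynomial[OF p(1) assms(3)] by (intro bexI[of _ "\<lambda>x. p (u x) - p 0"]) auto
qed

lemma max_mem: "u \<in> A \<Longrightarrow> v \<in> A \<Longrightarrow> (\<lambda>x. max (u x) (v x)) \<in> A"
proof -
  assume u: "u \<in> A" and v: "v \<in> A"
  have "(\<lambda>x. 1 / 2 * ((u x + v x) + \<bar>u x - v x\<bar>)) \<in> A"
    by (intro scale_mem add_mem compose[of abs] diff_mem u v) (auto intro: continuous_intros)
  moreover have "max (u x) (v x) = 1 / 2 * ((u x + v x) + \<bar>u x - v x\<bar>)" for x
    by (simp add: max_def abs_if field_simps)
  ultimately show ?thesis by presburger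
qed

lemma min_mem: "u \<in> A \<Longrightarrow> v \<in> A \<Longrightarrow> (\<lambda>x. min (u x) (v x)) \<in> A"
proof -
  assume u: "u \<in> A" and v: "v \<in> A"
  have "(\<lambda>x. (u x + v x) - max (u x) (v x)) \<in> A"
    by (intro diff_mem add_mem max_mem u v)
  moreover have "min (u x) (v x) = (u x + v x) - max (u x) (v x)" for x
    by (simp add: max_def min_def)
  ultimately show ?thesis by presburger
qed

section \<open>Interpolation at two points\<close>

lemma separating_function:
  assumes nz: "\<And>x. \<exists>v\<in>A. v x \<noteq> 0"
    and "w \<in> A" "w s \<noteq> w t"
  shows "\<exists>p\<in>A. p s = 1 \<and> p t = 0"
proof (cases "w s = 0")
  case False
  \<comment> \<open>The quadratic \<open>w * (w - w t)\<close> without constant term vanishes at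
    \<open>t\<close>, and at \<open>s\<close> it has the nonzero value used for
    normalisation.\<close>
  let ?p = "\<lambda>x. (1 / (w s * (w s - w t))) * (w x * w x - w t * w x)"
  have "?p \<in> A"
    by (intro scale_mem diff_mem mult_mem \<open>w \<in> A\<close>)
  moreover have "w s * w s - w t * w s = w s * (w s - w t)"
    by (simp add: algebra_simps)
  then have "?p s = 1" "?p t = 0"
    using False assms(3) by simp_all
  ultimately show ?thesis by (intro bexI[of _ ?p] conjI)
next
  case True
  then have "w t \<noteq> 0" using assms(3) by simp
  obtain m where m: "m \<in> A" "m s \<noteq> 0"
    using nz by blast
  \<comment> \<open>Here every polynomial in \<open>w\<close> without constant term vanishes at
    \<open>s\<close>. The value 1 at \<open>s\<close> comes from \<open>m\<close> instead, and a
    multiple of \<open>w\<close> cancels the value at \<open>t\<close> without disturbing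
    \<open>s\<close>.\<close>
  let ?p = "\<lambda>x. (1 / m s) * m x - (m t / (m s * w t)) * w x"
  have "?p \<in> A"
    by (intro scale_mem diff_mem m \<open>w \<in> A\<close>)
  moreover have "?p s = 1" "?p t = 0"
    using True m \<open>w t \<noteq> 0\<close> by simp_all
  ultimately show ?thesis by (intro bexI[of _ ?p] conjI)
qed

text \<open>If \<open>A\<close> separates the points, combine two functions that are 1 at one point
  and 0 at the other. Otherwise \<open>u\<close> agrees at both points, and a multiple of one
  function not vanishing there suffices.\<close>

lemma interpolation:
  assumes nz: "\<And>x. \<exists>v\<in>A. v x \<noteq> 0"
    and sep: "\<And>s t. (\<And>v. v \<in> A \<Longrightarrow> v s = v t) \<Longrightarrow> u s = u t"
  shows "\<exists>v\<in>A. v s = u s \<and> v t = u t"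
proof (cases "\<exists>w\<in>A. w s \<noteq> w t")
  case True
  then obtain w where w: "w \<in> A" "w s \<noteq> w t" by blast
  obtain p where p: "p \<in> A" "p s = 1" "p t = 0"
    using separating_function[OF nz w] by blast
  obtain q where q: "q \<in> A" "q t = 1" "q s = 0"
    using separating_function[OF nz w(1), of t s] w(2) by metis
  have "(\<lambda>x. u s * p x + u t * q x) \<in> A"
    by (intro add_mem scale_mem p q)
  then show ?thesis
    using p q by (intro bexI[of _ "\<lambda>x. u s * p x + u t * q x"]) auto
next
  case False
  obtain v where v: "v \<in> A" "v s \<noteq> 0"
    using nz by blast
  have "u s = u t"
    using False by (intro sep) blast
  moreover have "v s = v t"
    using False v by blast
  ultimately show ?thesis
    using v scale_mem[OF v(1), of "u s / v s"]
    by (intro bexI[of _ "\<lambda>x. u s / v s * v x"]) auto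
qed

end

section \<open>Approximation on compact sets\<close>

text \<open>The finite subcover argument, used once to form a finite maximum and once to form a
  finite minimum.\<close>

lemma compact_local_to_global:
  assumes "compact K" "Q {}"
    and Un: "\<And>U V. Q U \<Longrightarrow> Q V \<Longrightarrow> Q (U \<union> V)"
    and local: "\<And>x. x \<in> K \<Longrightarrow> \<exists>U. open U \<and> x \<in> U \<and> Q U"
  shows "\<exists>W. K \<subseteq> W \<and> Q W"
proof -
  have "K \<subseteq> \<Union>{U. open U \<and> Q U}"
    using local by (simp add: subset_iff) metis
  then obtain D where D: "D \<subseteq> {U. open U \<and> Q U}" "finite D" "K \<subseteq> \<Union>D"
    by (rule compactE[OF assms(1)]) simp
  have "Q (\<Union>D)"
    using D(2,1) by induction (simp_all add: \<open>Q {}\<close> Un)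
  then show ?thesis using D(3) by blast
qed

context uniform_algebra
begin

text \<open>For each \<open>t\<close>, a function matching \<open>u\<close> at \<open>s\<close> and
  \<open>t\<close> exceeds \<open>u - e\<close> near \<open>t\<close>. A finite maximum of such
  functions does so on all of \<open>K\<close> and keeps the exact value at
  \<open>s\<close>.\<close>

lemma approximation_from_above:
  assumes nz: "\<And>x. \<exists>v\<in>A. v x \<noteq> 0"
    and sep: "\<And>s t. (\<And>v. v \<in> A \<Longrightarrow> v s = v t) \<Longrightarrow> u s = u t"
    and u: "continuous_on UNIV u" and "compact K" "e > 0"
  shows "\<exists>v\<in>A. v s = u s \<and> (\<forall>x\<in>K. u x - e < v x)"
proof -
  define Q where "Q U \<longleftrightarrow> (\<exists>v\<in>A. v s = u s \<and> (\<forall>x\<in>U. u x - e < v x))" for U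
  have "\<exists>W. K \<subseteq> W \<and> Q W"
  proof (rule compact_local_to_global[OF \<open>compact K\<close>])
    show "Q {}"
      unfolding Q_def using interpolation[where u = u, OF nz sep] by fastforce
    show "Q (U \<union> V)" if UV: "Q U" "Q V" for U V
    proof -
      from UV obtain v w where v: "v \<in> A" "v s = u s" "\<forall>x\<in>U. u x - e < v x"
        and w: "w \<in> A" "w s = u s" "\<forall>x\<in>V. u x - e < w x"
        unfolding Q_def by blast
      then show ?thesis
        unfolding Q_def by (intro bexI[OF _ max_mem[OF v(1) w(1)]]) (auto simp: less_max_iff_disj)
    qed
    show "\<exists>U. open U \<and> t \<in> U \<and> Q U" for t
    proof -
      obtain v where v: "v \<in> A" "v s = u s" "v t = u t"
        using interpolation[where u = u, OF nz sep] by blast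
      have "open {x. u x - e < v x}"
        using continuous[OF v(1)] u by (intro open_Collect_less continuous_intros)
      then show ?thesis
        using v \<open>e > 0\<close> unfolding Q_def by (intro exI[of _ "{x. u x - e < v x}"]) auto
    qed
  qed
  then show ?thesis unfolding Q_def by blast
qed

text \<open>Dual step: each function from the previous lemma is below \<open>u + e\<close> near its
  point of exact agreement. A finite minimum achieves this on \<open>K\<close> and preserves the
  lower bound.\<close>

lemma approximation_on_compact:
  assumes nz: "\<And>x. \<exists>v\<in>A. v x \<noteq> 0"
    and sep: "\<And>s t. (\<And>v. v \<in> A \<Longrightarrow> v s = v t) \<Longrightarrow> u s = u t"
    and u: "continuous_on UNIV u" and "compact K" "e > 0"
  shows "\<exists>v\<in>A. \<forall>x\<in>K. \<bar>v x - u x\<bar> < e"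
proof -
  define Q where "Q U \<longleftrightarrow> (\<exists>v\<in>A. (\<forall>x\<in>K. u x - e < v x) \<and> (\<forall>x\<in>U. v x < u x + e))" for U
  note above = approximation_from_above[where u = u, OF nz sep u \<open>compact K\<close> \<open>e > 0\<close>]
  have "\<exists>W. K \<subseteq> W \<and> Q W"
  proof (rule compact_local_to_global[OF \<open>compact K\<close>])
    show "Q {}"
      unfolding Q_def using above by fastforce
    show "Q (U \<union> V)" if UV: "Q U" "Q V" for U V
    proof -
      from UV obtain v w where v: "v \<in> A" "\<forall>x\<in>K. u x - e < v x" "\<forall>x\<in>U. v x < u x + e"
        and w: "w \<in> A" "\<forall>x\<in>K. u x - e < w x" "\<forall>x\<in>V. w x < u x + e"
        unfolding Q_def by blast
      then show ?thesis
        unfolding Q_def by (intro bexI[OF _ min_mem[OF v(1) w(1)]]) (auto simp: min_less_iff_disj)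
    qed
    show "\<exists>U. open U \<and> t \<in> U \<and> Q U" for t
    proof -
      obtain v where v: "v \<in> A" "v t = u t" "\<forall>x\<in>K. u x - e < v x"
        using above by blast
      have "open {x. v x < u x + e}"
        using continuous[OF v(1)] u by (intro open_Collect_less continuous_intros)
      then show ?thesis
        using v \<open>e > 0\<close> unfolding Q_def by (intro exI[of _ "{x. v x < u x + e}"]) auto
    qed
  qed
  then obtain W v where "K \<subseteq> W" "v \<in> A" "\<forall>x\<in>K. u x - e < v x" "\<forall>x\<in>W. v x < u x + e"
    unfolding Q_def by blast
  then show ?thesis
    by (intro bexI[of _ v]) (auto simp: abs_less_iff algebra_simps subset_iff)
qed

lemma bounded_approximation_on_compact:
  assumes nz: "\<And>x. \<exists>v\<in>A. v x \<noteq> 0"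
    and sep: "\<And>s t. (\<And>v. v \<in> A \<Longrightarrow> v s = v t) \<Longrightarrow> u s = u t"
    and u: "continuous_on UNIV u" "\<And>x. \<bar>u x\<bar> \<le> M" and "compact K" "e > 0"
  shows "\<exists>v\<in>A. (\<forall>x. \<bar>v x\<bar> \<le> M) \<and> (\<forall>x\<in>K. \<bar>v x - u x\<bar> < e)"
proof -
  obtain v where v: "v \<in> A" "\<forall>x\<in>K. \<bar>v x - u x\<bar> < e"
    using approximation_on_compact[where u = u, OF nz sep u(1) \<open>compact K\<close> \<open>e > 0\<close>] by blast
  \<comment> \<open>Truncation to \<open>[-M, M]\<close> fixes 0, so it stays in \<open>A\<close>.
    It brings no value farther from \<open>u\<close>, whose values already lie in that
    interval.\<close>
  let ?\<phi> = "\<lambda>y. Orderings.max (-M) (Orderings.min M y)"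
  have "M \<ge> 0"
    using u(2)[of undefined] by linarith
  then have "(\<lambda>x. ?\<phi> (v x)) \<in> A"
    using v(1) by (intro compose[of ?\<phi>]) (auto intro!: continuous_intros)
  moreover have "\<bar>?\<phi> (v x)\<bar> \<le> M" "\<bar>?\<phi> (v x) - u x\<bar> \<le> \<bar>v x - u x\<bar>" for x
    using \<open>M \<ge> 0\<close> u(2)[of x] by linarith+
  ultimately show ?thesis
    using v(2) by (intro bexI[of _ "\<lambda>x. ?\<phi> (v x)"]) (auto intro: le_less_trans)
qed

end


section \<open>The strict topology\<close>

text \<open>The generating balls have arbitrary centres. Induction over the generation of open sets
  recentres them at \<open>f\<close>.\<close>

lemma seminorm_topology_neighbourhood:
  fixes P :: "('v::ab_group_add \<Rightarrow> real) set"
  assumes "openin (seminorm_topology P) U" "f \<in> U"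
    and triangle: "\<And>p x y. p \<in> P \<Longrightarrow> p (x + y) \<le> p x + p y"
  shows "\<exists>F e. finite F \<and> F \<subseteq> P \<and> e > 0 \<and> (\<forall>h. (\<forall>p\<in>F. p (h - f) < e) \<longrightarrow> h \<in> U)"
    (is "?N U")
proof -
  have "generate_topology_on {{x. p (x - x0) < r} | p x0 r. p \<in> P \<and> r > 0} U"
    using assms(1) unfolding seminorm_topology_def by (rule openin_topology_generated_by)
  then show ?thesis
    using \<open>f \<in> U\<close>
  proof induction
    case Empty
    then show ?case by simp
  next
    case (Int a b)
    then have "?N a" "?N b" by simp_all
    then obtain F e F' e' where F: "finite F" "F \<subseteq> P" "e > 0" "\<forall>h. (\<forall>p\<in>F. p (h - f) < e) \<longrightarrow> h \<in> a"
      and F': "finite F'" "F' \<subseteq> P" "e' > 0" "\<forall>h. (\<forall>p\<in>F'. p (h - f) < e') \<longrightarrow> h \<in> b"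
      by (elim exE conjE)
    show ?case
    proof (intro exI conjI allI impI)
      show "finite (F \<union> F')" "F \<union> F' \<subseteq> P" "min e e' > 0"
        using F(1-3) F'(1-3) by simp_all
      fix h
      assume "\<forall>p\<in>F \<union> F'. p (h - f) < min e e'"
      then show "h \<in> a \<inter> b"
        using F(4) F'(4) by simp
    qed
  next
    case (UN K)
    obtain a where a: "a \<in> K" "f \<in> a"
      using UN.prems by (rule UnionE)
    then have "?N a" by (rule UN.IH)
    then show ?case using a(1) by (elim ex_forward conj_forward all_forward imp_forward) auto
  next
    case (Basis a)
    then obtain p x0 r where p: "a = {x. p (x - x0) < r}" "p \<in> P" "r > 0"
      by blast
    \<comment> \<open>By subadditivity the ball of radius \<open>r - p (f - x0)\<close> about
      \<open>f\<close> lies in the ball of radius \<open>r\<close> about \<open>x0\<close>.\<close>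
    have "h \<in> a" if "p (h - f) < r - p (f - x0)" for h
      using triangle[OF p(2), of "h - f" "f - x0"] that p(1) by simp
    then show ?case
      using p Basis.prems by (intro exI[of _ "{p}"] exI[of _ "r - p (f - x0)"]) auto
  qed
qed

lemma bc_mult_apply [simp]: "apply_bcontfun (bc_mult f g) x = f x * g x"
  by (simp add: bc_mult.rep_eq)

lemma bc_cnj_apply [simp]: "apply_bcontfun (bc_cnj f) x = cnj (f x)"
  by (simp add: bc_cnj.rep_eq)

lemma bc_scale_apply [simp]: "apply_bcontfun (bc_scale c f) x = c * f x"
  by (simp add: bc_scale_def const_bcontfun.rep_eq)

lemma bc_add_apply [simp]:
  "apply_bcontfun (f + g) x = f x + g x" for f g :: "'a::topological_space \<Rightarrow>\<^sub>C complex"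
  by (simp add: plus_bcontfun.rep_eq)

lemma bc_diff_apply [simp]:
  "apply_bcontfun (f - g) x = f x - g x" for f g :: "'a::topological_space \<Rightarrow>\<^sub>C complex"
  by (simp add: minus_bcontfun.rep_eq)

lemma bc_zero_apply [simp]: "apply_bcontfun (0 :: 'a::topological_space \<Rightarrow>\<^sub>C complex) x = 0"
  by (simp add: zero_bcontfun.rep_eq)

lemma bc_mult_zero [simp]: "bc_mult 0 g = 0" "bc_mult g 0 = 0"
  by (rule bcontfun_eqI; simp)+

lemma strict_topology_neighbourhood:
  fixes f :: "'a::topological_space \<Rightarrow>\<^sub>C complex"
  assumes "openin strict_topology U" "f \<in> U"
  shows "\<exists>F e. finite F \<and> F \<subseteq> C0 \<and> e > 0 \<and>
    (\<forall>h. (\<forall>g\<in>F. norm (bc_mult (h - f) g) < e) \<longrightarrow> h \<in> U)"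
proof -
  have "bc_mult (x + y) g = bc_mult x g + bc_mult y g" for x y g :: "'a \<Rightarrow>\<^sub>C complex"
    by (rule bcontfun_eqI) (simp add: algebra_simps)
  then have "norm (bc_mult (x + y) g) \<le> norm (bc_mult x g) + norm (bc_mult y g)"
    for x y g :: "'a \<Rightarrow>\<^sub>C complex"
    by (simp add: norm_triangle_ineq)
  then have "p (x + y) \<le> p x + p y"
    if "p \<in> (\<lambda>g f. norm (bc_mult f g)) ` C0" for p and x y :: "'a \<Rightarrow>\<^sub>C complex"
    using that by blast
  from seminorm_topology_neighbourhood[OF assms[unfolded strict_topology_def] this]
  obtain P e where P: "finite P" "P \<subseteq> (\<lambda>g f. norm (bc_mult f g)) ` C0" "e > 0"
    "\<forall>h. (\<forall>p\<in>P. p (h - f) < e) \<longrightarrow> h \<in> U"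
    by blast
  obtain F where F: "F \<subseteq> C0" "finite F" "P = (\<lambda>g f. norm (bc_mult f g)) ` F"
    using finite_subset_image[OF P(1,2)] by blast
  then show ?thesis
    using P(3,4) by (intro exI[of _ F] exI[of _ e]) auto
qed

lemma openin_strict_topology_ball:
  assumes "g \<in> C0" "r > 0"
  shows "openin strict_topology {h. norm (bc_mult (h - f) g) < r}"
  unfolding strict_topology_def seminorm_topology_def openin_topology_generated_by_iff
  by (intro generate_topology_on.Basis CollectI exI[of _ "\<lambda>f. norm (bc_mult f g)"] exI[of _ f]
      exI[of _ r]) (use assms in auto)

lemma topspace_strict_topology [simp]: "topspace strict_topology = UNIV"
proof -
  have "0 \<in> C0"
    unfolding C0_def by auto
  \<comment> \<open>The seminorm attached to the zero function vanishes identically, so its unit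
    ball is the whole space.\<close>
  from openin_strict_topology_ball[OF this, of 1 0] have "openin strict_topology UNIV"
    by simp
  then show ?thesis
    by (simp add: topspace_def) blast
qed

section \<open>Point values in the strict topology\<close>

lemma Hausdorff_space_euclidean_t2: "Hausdorff_space (euclidean :: 'a::t2_space topology)"
  unfolding Hausdorff_space_def disjnt_def by simp (metis hausdorff)

text \<open>Lets a strict seminorm control the value at \<open>t\<close>. Complete regularity gives
  \<open>f\<close> with value 0 at \<open>t\<close> and 1 outside a neighbourhood contained in a
  compact set; take \<open>1 - f\<close>.\<close>

lemma C0_bump:
  fixes t :: "'a::t2_space"
  assumes "locally_compact_space (euclidean :: 'a topology)"
  shows "\<exists>g\<in>C0. apply_bcontfun g t = 1"
proof -
  obtain U K where U: "open U" "compact K" "t \<in> U" "U \<subseteq> K"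
    using assms unfolding locally_compact_space_def by simp metis
  have "completely_regular_space (euclidean :: 'a topology)"
    using assms Hausdorff_space_euclidean_t2
    by (intro locally_compact_regular_imp_completely_regular_space) auto
  moreover have "closedin euclidean (- U) \<and> t \<in> topspace euclidean - (- U)"
    using U(1,3) by (simp add: closed_Compl)
  ultimately have "\<exists>f :: 'a \<Rightarrow> real. continuous_map euclidean (top_of_set {0..1}) f \<and>
      f t = 0 \<and> f ` (- U) \<subseteq> {1}"
    unfolding completely_regular_space_def by (elim allE impE)
  then obtain f :: "'a \<Rightarrow> real" where f: "continuous_map euclidean (top_of_set {0..1}) f"
      "f t = 0" "f ` (- U) \<subseteq> {1}"
    by blast
  have "f x \<in> {0..1}" for x
    using f(1) by (auto simp: continuous_map_in_subtopology)
  moreover have "continuous_on UNIV f"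
    using f(1) by (auto simp: continuous_map_in_subtopology)
  ultimately have "(\<lambda>x. complex_of_real (1 - f x)) \<in> bcontfun"
    by (intro bcontfun_normI[where b = 1] continuous_intros) (auto simp: norm_of_real simp del: of_real_diff)
  then obtain g where g: "apply_bcontfun g = (\<lambda>x. complex_of_real (1 - f x))"
    by (metis bcontfunE)
  then have "g x = 0" if "x \<notin> K" for x
    using that U(4) f(3) by force
  then have "g \<in> C0"
    unfolding C0_def using U(2) by force
  then show ?thesis
    using f(2) g by (intro bexI[of _ g]) auto
qed

lemma closedin_strict_topology_Collect_eq:
  fixes a b :: "'a::t2_space"
  assumes "locally_compact_space (euclidean :: 'a topology)"
  shows "closedin strict_topology {f. apply_bcontfun f a = apply_bcontfun f b}"
proof -
  obtain ga gb where g: "ga \<in> C0" "apply_bcontfun ga a = 1" "gb \<in> C0" "apply_bcontfun gb b = 1"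
    using C0_bump[OF assms] by meson
  have "openin strict_topology (UNIV - {f. apply_bcontfun f a = apply_bcontfun f b})"
  proof (subst openin_subopen, intro ballI)
    fix f :: "'a \<Rightarrow>\<^sub>C complex"
    assume f: "f \<in> UNIV - {f. apply_bcontfun f a = apply_bcontfun f b}"
    \<comment> \<open>Half the gap between the two values of \<open>f\<close>: moving each by less
      than \<open>r\<close> cannot make them equal.\<close>
    define r where "r = norm (f a - f b) / 2"
    have "r > 0"
      using f by (simp add: r_def)
    let ?T = "{h. norm (bc_mult (h - f) ga) < r} \<inter> {h. norm (bc_mult (h - f) gb) < r}"
    have "openin strict_topology ?T"
      using openin_strict_topology_ball g \<open>r > 0\<close> by blast
    moreover have "f \<in> ?T"
      using \<open>r > 0\<close> by simp
    moreover have "h a \<noteq> h b" if "h \<in> ?T" for h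
    proof
      assume "h a = h b"
      have "norm (h a - f a) < r" "norm (h b - f b) < r"
        using norm_bounded[of "bc_mult (h - f) ga" a] norm_bounded[of "bc_mult (h - f) gb" b] that g
        by auto
      then have "norm ((h b - f b) - (h a - f a)) < r + r"
        by (meson add_strict_mono le_less_trans norm_triangle_ineq4)
      then show False
        using \<open>h a = h b\<close> by (simp add: r_def)
    qed
    ultimately show "\<exists>T. openin strict_topology T \<and> f \<in> T \<and>
        T \<subseteq> UNIV - {f. apply_bcontfun f a = apply_bcontfun f b}"
      by (intro exI[of _ ?T]) auto
  qed
  then show ?thesis
    by (simp add: closedin_def)
qed

lemma closed_Collect_bcontfun_eq:
  "closed {f :: 'a::topological_space \<Rightarrow>\<^sub>C complex. apply_bcontfun f a = apply_bcontfun f b}"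
proof -
  have "continuous_on UNIV (\<lambda>f :: 'a \<Rightarrow>\<^sub>C complex. apply_bcontfun f x)" for x
    unfolding continuous_on_iff using dist_bounded le_less_trans by blast
  then show ?thesis
    by (intro closed_Collect_eq)
qed

section \<open>A Stone--Weierstrass theorem for the strict topology\<close>

text \<open>The self-adjoint part of \<open>X\<close>, read as real-valued functions so that lattice
  arguments apply.\<close>

definition real_functions :: "('a::topological_space \<Rightarrow>\<^sub>C complex) set \<Rightarrow> ('a \<Rightarrow> real) set"
  where "real_functions X = {u. \<exists>f\<in>X. \<forall>x. apply_bcontfun f x = of_real (u x)}"

lemma uniform_algebra_real_functions:
  assumes "cstar_subalgebra X"
  shows "uniform_algebra (real_functions X)"
proof
  fix u
  assume "u \<in> real_functions X"
  then obtain f where f: "\<And>x. apply_bcontfun f x = complex_of_real (u x)"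
    unfolding real_functions_def by blast
  then have u: "u = (\<lambda>x. Re (f x))"
    by simp
  show "continuous_on UNIV u"
    unfolding u by (intro continuous_intros continuous_on_apply_bcontfun)
  show "\<exists>M. \<forall>x. \<bar>u x\<bar> \<le> M"
    unfolding u by (meson abs_Re_le_cmod norm_bounded order_trans)
next
  show "(\<lambda>x. 0) \<in> real_functions X"
    using assms unfolding real_functions_def cstar_subalgebra_def by (auto intro!: bexI[of _ 0])
next
  fix u v
  assume "u \<in> real_functions X" "v \<in> real_functions X"
  then obtain f g where f: "f \<in> X" "\<And>x. apply_bcontfun f x = of_real (u x)"
    and g: "g \<in> X" "\<And>x. apply_bcontfun g x = of_real (v x)"
    unfolding real_functions_def by blast
  have "f + g \<in> X" "bc_mult f g \<in> X"
    using assms f g unfolding cstar_subalgebra_def by blast+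
  then show "(\<lambda>x. u x + v x) \<in> real_functions X" "(\<lambda>x. u x * v x) \<in> real_functions X"
    unfolding real_functions_def using f g
    by (auto intro: bexI[where x = "f + g"] bexI[where x = "bc_mult f g"])
next
  fix u c
  assume "u \<in> real_functions X"
  then obtain f where f: "f \<in> X" "\<And>x. apply_bcontfun f x = of_real (u x)"
    unfolding real_functions_def by blast
  then have "bc_scale (of_real c) f \<in> X"
    using assms unfolding cstar_subalgebra_def by blast
  then show "(\<lambda>x. c * u x) \<in> real_functions X"
    unfolding real_functions_def using f by (auto intro!: bexI[of _ "bc_scale (of_real c) f"])
next
  fix u :: "'a \<Rightarrow> real"
  assume *: "\<And>e. e > 0 \<Longrightarrow> \<exists>v\<in>real_functions X. \<forall>x. \<bar>v x - u x\<bar> \<le> e"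
  have "\<exists>f\<in>X. \<forall>x. norm (apply_bcontfun f x - of_real (u x)) \<le> inverse (Suc n)" for n
  proof -
    obtain v f where "\<forall>x. \<bar>v x - u x\<bar> \<le> inverse (Suc n)" "f \<in> X"
        "\<And>x. apply_bcontfun f x = of_real (v x)"
      using *[of "inverse (Suc n)"] unfolding real_functions_def by auto
    then show ?thesis
      by (intro bexI[of _ f]) (simp_all flip: of_real_diff)
  qed
  then obtain f where f: "\<And>n. f n \<in> X"
    "\<And>n x. norm (apply_bcontfun (f n) x - of_real (u x)) \<le> inverse (Suc n)"
    by metis
  have "uniform_limit UNIV (\<lambda>n. apply_bcontfun (f n)) (\<lambda>x. complex_of_real (u x)) sequentially"
  proof (rule uniform_limitI)
    fix e :: real
    assume "e > 0"
    with LIMSEQ_inverse_real_of_nat have "\<forall>\<^sub>F n in sequentially. inverse (Suc n) < e"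
      by (rule order_tendstoD(2))
    then show "\<forall>\<^sub>F n in sequentially. \<forall>x\<in>UNIV. dist (f n x) (complex_of_real (u x)) < e"
      by eventually_elim (auto simp: dist_norm intro: le_less_trans f(2))
  qed
  \<comment> \<open>Uniform convergence makes the limit an element of the Banach space, and norm
    closedness puts it in \<open>X\<close>.\<close>
  then obtain l where l: "(\<lambda>x. complex_of_real (u x)) = apply_bcontfun l" "f \<longlonglongrightarrow> l"
    by (rule uniform_limit_bcontfunE) auto
  have "l \<in> X"
    using assms f(1) l(2) closed_sequentially[of X f l] unfolding cstar_subalgebra_def by blast
  then show "u \<in> real_functions X"
    unfolding real_functions_def using l(1)[symmetric] by (auto intro!: bexI[of _ l])
qed

lemma Re_Im_mem_real_functions:
  assumes X: "cstar_subalgebra X" and f: "f \<in> X"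
  shows "(\<lambda>x. Re (apply_bcontfun f x)) \<in> real_functions X"
    and "(\<lambda>x. Im (apply_bcontfun f x)) \<in> real_functions X"
proof -
  have cl: "f + g \<in> X" "bc_scale c f \<in> X" "bc_cnj f \<in> X" if "f \<in> X" "g \<in> X" for f g c
    using X that unfolding cstar_subalgebra_def by blast+
  have "bc_scale (1 / 2) (f + bc_cnj f) \<in> X"
    using f cl by blast
  then show "(\<lambda>x. Re (apply_bcontfun f x)) \<in> real_functions X"
    unfolding real_functions_def
    by (intro CollectI bexI[of _ "bc_scale (1 / 2) (f + bc_cnj f)"]) (auto simp: complex_eq_iff)
  have "bc_scale (- \<i> / 2) (f + bc_scale (-1) (bc_cnj f)) \<in> X"
    using f cl by blast
  then show "(\<lambda>x. Im (apply_bcontfun f x)) \<in> real_functions X"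
    unfolding real_functions_def
    by (intro CollectI bexI[of _ "bc_scale (- \<i> / 2) (f + bc_scale (-1) (bc_cnj f))"])
      (auto simp: complex_eq_iff)
qed

text \<open>Real and imaginary parts are approximated separately; adding their bounds gives the
  factor 2. What matters is that this bound is independent of \<open>K\<close> and
  \<open>e\<close>.\<close>

lemma bounded_approximation_in_cstar_subalgebra:
  fixes f :: "'a::topological_space \<Rightarrow>\<^sub>C complex"
  assumes X: "cstar_subalgebra X"
    and nz: "\<And>x. \<exists>g\<in>X. apply_bcontfun g x \<noteq> 0"
    and sep: "\<And>s t. (\<And>g. g \<in> X \<Longrightarrow> apply_bcontfun g s = apply_bcontfun g t) \<Longrightarrow> f s = f t"
    and "compact K" "e > 0"
  shows "\<exists>h\<in>X. (\<forall>x. norm (h x) \<le> 2 * norm f) \<and> (\<forall>x\<in>K. norm (h x - f x) < e)"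
proof -
  interpret uniform_algebra "real_functions X"
    using X by (rule uniform_algebra_real_functions)
  note mem = Re_Im_mem_real_functions[OF X]
  have nz': "\<exists>v\<in>real_functions X. v x \<noteq> 0" for x
  proof -
    obtain g where "g \<in> X" "Re (g x) \<noteq> 0 \<or> Im (g x) \<noteq> 0"
      using nz[of x] by (auto simp: complex_eq_iff)
    then show ?thesis
      using mem[OF \<open>g \<in> X\<close>] by (elim disjE) (rule bexI, assumption+)+
  qed
  have sep': "f s = f t" if "\<And>v. v \<in> real_functions X \<Longrightarrow> v s = v t" for s t
    using that mem by (intro sep complex_eqI) blast+
  have le: "\<bar>Re (f x)\<bar> \<le> norm f" "\<bar>Im (f x)\<bar> \<le> norm f" for x
    by (meson abs_Re_le_cmod abs_Im_le_cmod norm_bounded order_trans)+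
  have cont: "continuous_on UNIV (\<lambda>x. Re (f x))" "continuous_on UNIV (\<lambda>x. Im (f x))"
    by (intro continuous_intros continuous_on_apply_bcontfun)+
  obtain v where v: "v \<in> real_functions X" "\<forall>x. \<bar>v x\<bar> \<le> norm f" "\<forall>x\<in>K. \<bar>v x - Re (f x)\<bar> < e / 2"
    using bounded_approximation_on_compact[where u = "\<lambda>x. Re (f x)", OF nz' _ cont(1) le(1) \<open>compact K\<close>,
        of "e / 2"] sep' \<open>e > 0\<close> by (metis half_gt_zero)
  obtain w where w: "w \<in> real_functions X" "\<forall>x. \<bar>w x\<bar> \<le> norm f" "\<forall>x\<in>K. \<bar>w x - Im (f x)\<bar> < e / 2"
    using bounded_approximation_on_compact[where u = "\<lambda>x. Im (f x)", OF nz' _ cont(2) le(2) \<open>compact K\<close>,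
        of "e / 2"] sep' \<open>e > 0\<close> by (metis half_gt_zero)
  obtain a b where a: "a \<in> X" "\<And>x. apply_bcontfun a x = of_real (v x)"
    and b: "b \<in> X" "\<And>x. apply_bcontfun b x = of_real (w x)"
    using v(1) w(1) unfolding real_functions_def by blast
  define h where "h = a + bc_scale \<i> b"
  have "h \<in> X"
    using X a b unfolding h_def cstar_subalgebra_def by blast
  have h: "Re (h x) = v x" "Im (h x) = w x" for x
    by (simp_all add: h_def a b)
  have "norm (h x) \<le> 2 * norm f" for x
    using cmod_le[of "h x"] v(2)[rule_format, of x] w(2)[rule_format, of x] by (simp add: h)
  moreover have "norm (h x - f x) < e" if "x \<in> K" for x
    using cmod_le[of "h x - f x"] v(3)[rule_format, OF that] w(3)[rule_format, OF that] by (simp add: h)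
  ultimately show ?thesis
    using \<open>h \<in> X\<close> by blast
qed

text \<open>A basic strict neighbourhood of \<open>f\<close> involves finitely many weights, all
  small outside one compact set. A bounded approximant that is accurate on that set enters the
  neighbourhood.\<close>

theorem strict_Stone_Weierstrass:
  fixes f :: "'a::topological_space \<Rightarrow>\<^sub>C complex"
  assumes X: "cstar_subalgebra X" and closed: "closedin strict_topology X"
    and nz: "\<And>x. \<exists>g\<in>X. apply_bcontfun g x \<noteq> 0"
    and sep: "\<And>s t. (\<And>g. g \<in> X \<Longrightarrow> apply_bcontfun g s = apply_bcontfun g t) \<Longrightarrow> f s = f t"
  shows "f \<in> X"
proof (rule ccontr)
  assume "f \<notin> X"
  moreover have "openin strict_topology (UNIV - X)"
    using closed by (simp add: closedin_def)
  ultimately obtain F e where F: "finite F" "F \<subseteq> C0" "e > 0"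
    "\<And>h. (\<forall>g\<in>F. norm (bc_mult (h - f) g) < e) \<Longrightarrow> h \<notin> X"
    using strict_topology_neighbourhood[of "UNIV - X" f] by auto
  \<comment> \<open>\<open>M\<close> will bound \<open>h - f\<close> for an approximant with norm at
    most \<open>2 * norm f\<close>, and \<open>B\<close> bounds all weights. The summands 1 keep
    both positive for the divisions below.\<close>
  define M where "M = 3 * norm f + 1"
  define B where "B = (\<Sum>g\<in>F. norm g) + 1"
  have M: "M > 0" and B: "B > 0"
    by (simp_all add: M_def B_def add_nonneg_pos sum_nonneg)
  have "norm g \<le> (\<Sum>g\<in>F. norm g)" if "g \<in> F" for g
    using F(1) that by (intro member_le_sum) auto
  then have le_B: "norm (g x) \<le> B" if "g \<in> F" for g x
    using norm_bounded[of g x] that unfolding B_def by fastforce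
  have "\<forall>g\<in>F. \<exists>K. compact K \<and> (\<forall>x. x \<notin> K \<longrightarrow> norm (apply_bcontfun g x) < e / (2 * M))"
    using F(2) M \<open>e > 0\<close> unfolding C0_def by auto
  then obtain K where K: "\<And>g. g \<in> F \<Longrightarrow> compact (K g)"
    "\<And>g x. g \<in> F \<Longrightarrow> x \<notin> K g \<Longrightarrow> norm (apply_bcontfun g x) < e / (2 * M)"
    by metis
  have "compact (\<Union>g\<in>F. K g)"
    using F(1) K(1) by (intro compact_UN) auto
  moreover have "e / (2 * B) > 0"
    using B \<open>e > 0\<close> by simp
  ultimately obtain h where h: "h \<in> X" "\<And>x. norm (apply_bcontfun h x) \<le> 2 * norm f"
      "\<And>x. x \<in> (\<Union>g\<in>F. K g) \<Longrightarrow> norm (h x - f x) < e / (2 * B)"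
    using bounded_approximation_in_cstar_subalgebra[where f = f, OF X nz sep] by metis
  \<comment> \<open>On \<open>K g\<close> the difference is small and the weight at most
    \<open>B\<close>; elsewhere the difference is at most \<open>M\<close> and the weight small.
    Aiming at \<open>e / 2\<close> leaves room for strictness after taking the supremum.\<close>
  have "norm (bc_mult (h - f) g) \<le> e / 2" if g: "g \<in> F" for g
  proof (rule norm_bound)
    fix x
    show "norm (apply_bcontfun (bc_mult (h - f) g) x) \<le> e / 2"
    proof (cases "x \<in> K g")
      case True
      then have "norm (h x - f x) * norm (g x) \<le> e / (2 * B) * B"
        using h(3)[of x] le_B[OF g, of x] g B \<open>e > 0\<close> by (intro mult_mono) (auto intro: less_imp_le)
      then show ?thesis
        using B by (simp add: norm_mult)
    next
      case False
      have "norm (h x - f x) \<le> M"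
        using norm_triangle_ineq4[of "h x" "f x"] h(2)[of x] norm_bounded[of f x] by (simp add: M_def)
      then have "norm (h x - f x) * norm (g x) \<le> M * (e / (2 * M))"
        using K(2)[OF g False] M by (intro mult_mono) auto
      then show ?thesis
        using M by (simp add: norm_mult)
    qed
  qed
  then have "\<forall>g\<in>F. norm (bc_mult (h - f) g) < e"
    using \<open>e > 0\<close> by fastforce
  then show False
    using F(4) h(1) by blast
qed


section \<open>Closed subgroups and invariant algebras\<close>

lemma fixed_algebra_iff:
  "f \<in> fixed_algebra G H \<longleftrightarrow> (\<forall>s\<in>H. \<forall>t. apply_bcontfun f (t \<otimes>\<^bsub>G\<^esub> s) = apply_bcontfun f t)"
  by (simp add: fixed_algebra_def right_translate_def fun_eq_iff)

context locally_compact_group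
begin

declare carrier_UNIV [simp]

lemma right_stabilizer_iff:
  "s \<in> right_stabilizer G X \<longleftrightarrow> (\<forall>f\<in>X. \<forall>t. apply_bcontfun f (t \<otimes> s) = apply_bcontfun f t)"
  by (simp add: right_stabilizer_def right_translate_def fun_eq_iff)

lemma mult_inv_cancel: "x \<otimes> (inv x \<otimes> y) = y"
  by (simp flip: m_assoc)

lemma continuous_on_mult:
  "continuous_on UNIV f \<Longrightarrow> continuous_on UNIV g \<Longrightarrow> continuous_on UNIV (\<lambda>x. f x \<otimes> g x)"
  using continuous_on_compose2[OF continuous_mult, of UNIV "\<lambda>x. (f x, g x)"]
  by (simp add: continuous_on_Pair)

lemma continuous_on_inv: "continuous_on UNIV f \<Longrightarrow> continuous_on UNIV (\<lambda>x. inv (f x))"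
  using continuous_on_compose2[OF continuous_inv, of UNIV f] by simp

lemma left_translate_bcontfun:
  fixes f :: "'a \<Rightarrow>\<^sub>C complex"
  shows "\<exists>g. apply_bcontfun g = left_translate G s (apply_bcontfun f)"
proof -
  have "continuous_on UNIV (\<lambda>t. apply_bcontfun f (s \<otimes> t))"
    by (rule continuous_on_compose2[OF continuous_on_apply_bcontfun[of UNIV f]])
      (auto intro!: continuous_on_mult continuous_intros)
  then have "(\<lambda>t. apply_bcontfun f (s \<otimes> t)) \<in> bcontfun"
    using norm_bounded by (rule bcontfun_normI)
  then show ?thesis
    unfolding left_translate_def by (metis bcontfunE)
qed

lemma right_translate_bcontfun:
  fixes f :: "'a \<Rightarrow>\<^sub>C complex"
  shows "\<exists>g. apply_bcontfun g = right_translate G s (apply_bcontfun f)"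
proof -
  have "continuous_on UNIV (\<lambda>t. apply_bcontfun f (t \<otimes> s))"
    by (rule continuous_on_compose2[OF continuous_on_apply_bcontfun[of UNIV f]])
      (auto intro!: continuous_on_mult continuous_intros)
  then have "(\<lambda>t. apply_bcontfun f (t \<otimes> s)) \<in> bcontfun"
    using norm_bounded by (rule bcontfun_normI)
  then show ?thesis
    unfolding right_translate_def by (metis bcontfunE)
qed

section \<open>The two assignments are well defined\<close>

text \<open>By associativity, left translations commute with right translations.\<close>

lemma left_invariant_fixed_algebra: "left_invariant G (fixed_algebra G H)"
  unfolding left_invariant_def
proof (intro ballI)
  fix f s
  assume f: "f \<in> fixed_algebra G H"
  obtain g where g: "apply_bcontfun g = left_translate G s (apply_bcontfun f)"
    using left_translate_bcontfun by blast
  have "g \<in> fixed_algebra G H"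
    using f unfolding fixed_algebra_iff by (simp add: g left_translate_def flip: m_assoc)
  then show "left_translate G s (apply_bcontfun f) \<in> apply_bcontfun ` fixed_algebra G H"
    using g by (metis imageI)
qed

lemma fixed_algebra_mem_left_invariant_algebras:
  assumes "H \<noteq> {}"
  shows "fixed_algebra G H \<in> left_invariant_algebras G"
proof -
  \<comment> \<open>Each condition equates two point values, so it is closed in the norm and in the
    strict topology. A nonempty \<open>H\<close> makes the intersection a nonempty one, as
    \<open>closedin_Inter\<close> demands.\<close>
  have eq: "fixed_algebra G H = (\<Inter>(s, t)\<in>H \<times> UNIV. {f. apply_bcontfun f (t \<otimes> s) = apply_bcontfun f t})"
    by (auto simp: fixed_algebra_iff)
  have "closed (fixed_algebra G H)"
    unfolding eq by (intro closed_INT) (auto intro: closed_Collect_bcontfun_eq)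
  then have "cstar_subalgebra (fixed_algebra G H)"
    unfolding cstar_subalgebra_def by (simp add: fixed_algebra_iff)
  moreover have "closedin strict_topology (fixed_algebra G H)"
    unfolding eq using assms locally_compact
    by (intro closedin_Inter) (auto intro: closedin_strict_topology_Collect_eq)
  moreover have "const_bcontfun 1 \<in> fixed_algebra G H" "const_bcontfun 1 \<noteq> (0 :: 'a \<Rightarrow>\<^sub>C complex)"
    by (auto simp: fixed_algebra_iff const_bcontfun.rep_eq dest!: arg_cong[of _ _ "\<lambda>f. apply_bcontfun f \<one>"])
  ultimately show ?thesis
    unfolding left_invariant_algebras_def using left_invariant_fixed_algebra by blast
qed

lemma right_stabilizer_mem_closed_subgroups: "right_stabilizer G X \<in> closed_subgroups G"
proof -
  have "right_stabilizer G X = (\<Inter>(f, t)\<in>X \<times> UNIV. {s. apply_bcontfun f (t \<otimes> s) = apply_bcontfun f t})"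
    by (auto simp: right_stabilizer_iff)
  moreover have "closed {s. apply_bcontfun f (t \<otimes> s) = apply_bcontfun f t}" for f :: "'a \<Rightarrow>\<^sub>C complex" and t
    by (intro closed_Collect_eq continuous_on_compose2[OF continuous_on_apply_bcontfun[of UNIV f]]
        continuous_on_mult continuous_intros) auto
  ultimately have "closed (right_stabilizer G X)"
    by (auto intro!: closed_INT)
  moreover have "subgroup (right_stabilizer G X) G"
  proof (rule subgroupI)
    show "right_stabilizer G X \<noteq> {}"
      using right_stabilizer_iff[of \<one> X] by auto
    show "inv s \<in> right_stabilizer G X" if "s \<in> right_stabilizer G X" for s
      unfolding right_stabilizer_iff
    proof (intro ballI allI)
      fix f t
      assume "f \<in> X"
      \<comment> \<open>Invariance under \<open>s\<close>, evaluated at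
        \<open>t \<otimes> inv s\<close>, is invariance under \<open>inv s\<close> at
        \<open>t\<close>.\<close>
      then have "apply_bcontfun f ((t \<otimes> inv s) \<otimes> s) = apply_bcontfun f (t \<otimes> inv s)"
        using that unfolding right_stabilizer_iff by blast
      then show "apply_bcontfun f (t \<otimes> inv s) = apply_bcontfun f t"
        by (simp add: m_assoc)
    qed
    show "s \<otimes> s' \<in> right_stabilizer G X"
      if "s \<in> right_stabilizer G X" "s' \<in> right_stabilizer G X" for s s'
      using that unfolding right_stabilizer_iff by (simp flip: m_assoc)
  qed simp
  ultimately show ?thesis
    by (simp add: closed_subgroups_def)
qed

section \<open>Recovering a closed subgroup\<close>

text \<open>The separating function is lifted from the locally compact Hausdorff, hence completely regular,
  space of left cosets; a coset is encoded as \<open>{y. inv x \<otimes> y \<in> H}\<close>.\<close>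

lemma fixed_algebra_separates:
  assumes H: "H \<in> closed_subgroups G" and "s \<notin> H"
  shows "\<exists>f\<in>fixed_algebra G H. apply_bcontfun f s \<noteq> apply_bcontfun f \<one>"
proof -
  interpret H: subgroup H G
    using H by (simp add: closed_subgroups_def)
  define \<pi> where "\<pi> x = {y. inv x \<otimes> y \<in> H}" for x
  have \<pi>_eq: "\<pi> x = \<pi> y \<longleftrightarrow> inv x \<otimes> y \<in> H" for x y
  proof
    show "inv x \<otimes> y \<in> H" if "\<pi> x = \<pi> y"
    proof -
      have "y \<in> \<pi> y" by (simp add: \<pi>_def)
      then have "y \<in> \<pi> x" using that by simp
      then show ?thesis by (simp add: \<pi>_def)
    qed
    show "\<pi> x = \<pi> y" if "inv x \<otimes> y \<in> H"
    proof -
      have "inv y \<otimes> x \<in> H"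
        using H.m_inv_closed[OF that] by (simp add: inv_mult_group)
      moreover have "inv y \<otimes> z = (inv y \<otimes> x) \<otimes> (inv x \<otimes> z)"
          "inv x \<otimes> z = (inv x \<otimes> y) \<otimes> (inv y \<otimes> z)" for z
        by (simp_all add: m_assoc mult_inv_cancel)
      ultimately show ?thesis
        unfolding \<pi>_def using that H.m_closed by (metis (no_types, lifting))
    qed
  qed
  \<comment> \<open>The quotient topology of \<open>G/H\<close>, carried by the range of
    \<open>\<pi>\<close>.\<close>
  define Q where "Q = topology (\<lambda>U. U \<subseteq> range \<pi> \<and> open (\<pi> -` U))"
  have "istopology (\<lambda>U. U \<subseteq> range \<pi> \<and> open (\<pi> -` U))"
    unfolding istopology_def by (auto simp: vimage_Union)
  then have openin_Q: "openin Q U \<longleftrightarrow> U \<subseteq> range \<pi> \<and> open (\<pi> -` U)" for U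
    unfolding Q_def by (simp add: topology_inverse')
  have topspace_Q: "topspace Q = range \<pi>"
  proof (rule equalityI)
    show "topspace Q \<subseteq> range \<pi>"
      using openin_Q openin_topspace by blast
    have "\<pi> -` range \<pi> = UNIV"
      by auto
    then show "range \<pi> \<subseteq> topspace Q"
      by (intro openin_subset) (simp add: openin_Q)
  qed
  have cont: "continuous_map euclidean Q \<pi>"
    unfolding continuous_map_def using topspace_Q openin_Q by (auto simp: vimage_def)
  have open_\<pi>: "openin Q (\<pi> ` U)" if "open U" for U
  proof -
    \<comment> \<open>The saturation of \<open>U\<close> is a union of right translates of
      \<open>U\<close>, hence open. Thus \<open>\<pi>\<close> is an open map and transports local
      compactness.\<close>
    have "\<pi> -` \<pi> ` U = (\<Union>h\<in>H. (\<lambda>x. x \<otimes> h) -` U)"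
    proof (intro equalityI subsetI)
      fix x
      assume "x \<in> \<pi> -` \<pi> ` U"
      then obtain y where "y \<in> U" "inv x \<otimes> y \<in> H"
        using \<pi>_eq by auto
      then show "x \<in> (\<Union>h\<in>H. (\<lambda>x. x \<otimes> h) -` U)"
        by (intro UN_I[of "inv x \<otimes> y"]) (simp_all flip: m_assoc)
    next
      fix x
      assume "x \<in> (\<Union>h\<in>H. (\<lambda>x. x \<otimes> h) -` U)"
      then obtain h where "h \<in> H" "x \<otimes> h \<in> U" by blast
      moreover have "inv x \<otimes> (x \<otimes> h) = h"
        by (simp flip: m_assoc)
      ultimately have "\<pi> x = \<pi> (x \<otimes> h)"
        using \<pi>_eq by simp
      then show "x \<in> \<pi> -` \<pi> ` U"
        using \<open>x \<otimes> h \<in> U\<close> by blast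
    qed
    moreover have "open ((\<lambda>x. x \<otimes> h) -` U)" for h
      using that by (intro open_vimage continuous_on_mult continuous_intros)
    ultimately show ?thesis
      using openin_Q by auto
  qed
  have "locally_compact_space Q"
    using locally_compact_space_continuous_open_map_image[OF cont] open_\<pi> topspace_Q locally_compact
    by (simp add: open_map_def)
  moreover have "Hausdorff_space Q"
    unfolding Hausdorff_space_def topspace_Q
  proof (intro allI impI, elim conjE imageE)
    fix p q x y
    assume pq: "p \<noteq> q" "p = \<pi> x" "q = \<pi> y"
    \<comment> \<open>Since \<open>H\<close> is closed, the pairs lying in different cosets form an
      open set. An open box inside it projects to disjoint open sets of cosets.\<close>
    have "open ((\<lambda>z. inv (fst z) \<otimes> snd z) -` (- H))"
      using H by (intro open_vimage continuous_on_mult continuous_on_inv continuous_intros)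
        (simp add: closed_subgroups_def)
    moreover have "(x, y) \<in> (\<lambda>z. inv (fst z) \<otimes> snd z) -` (- H)"
      using pq \<pi>_eq by simp
    ultimately obtain U V where UV: "open U" "open V" "(x, y) \<in> U \<times> V"
      "U \<times> V \<subseteq> (\<lambda>z. inv (fst z) \<otimes> snd z) -` (- H)"
      by (rule open_prod_elim)
    have "\<pi> u \<noteq> \<pi> v" if "u \<in> U" "v \<in> V" for u v
      using UV(4) that \<pi>_eq by fastforce
    then have "disjnt (\<pi> ` U) (\<pi> ` V)"
      unfolding disjnt_iff by blast
    then show "\<exists>U V. openin Q U \<and> openin Q V \<and> p \<in> U \<and> q \<in> V \<and> disjnt U V"
      using open_\<pi> UV pq by blast
  qed
  ultimately have "completely_regular_space Q"
    by (intro locally_compact_regular_imp_completely_regular_space) auto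
  moreover have "closedin Q {\<pi> s} \<and> \<pi> \<one> \<in> topspace Q - {\<pi> s}"
    using \<open>Hausdorff_space Q\<close> \<open>s \<notin> H\<close> \<pi>_eq[of \<one> s] topspace_Q
    by (auto intro: closedin_Hausdorff_singleton)
  ultimately have "\<exists>u :: 'a set \<Rightarrow> real. continuous_map Q (top_of_set {0..1}) u \<and>
      u (\<pi> \<one>) = 0 \<and> u ` {\<pi> s} \<subseteq> {1}"
    unfolding completely_regular_space_def by (elim allE impE)
  then obtain u :: "'a set \<Rightarrow> real" where u: "continuous_map Q (top_of_set {0..1}) u"
      "u (\<pi> \<one>) = 0" "u ` {\<pi> s} \<subseteq> {1}"
    by blast
  have u': "continuous_map euclidean (top_of_set {0..1}) (u \<circ> \<pi>)"
    using cont u(1) by (rule continuous_map_compose)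
  have "u (\<pi> x) \<in> {0..1}" for x
    using u' by (auto simp: continuous_map_in_subtopology Pi_iff)
  then have "(\<lambda>x. complex_of_real (u (\<pi> x))) \<in> bcontfun"
    using u' by (intro bcontfun_normI[where b = 1] continuous_intros)
      (auto simp: continuous_map_in_subtopology o_def)
  then obtain f where f: "apply_bcontfun f = (\<lambda>x. complex_of_real (u (\<pi> x)))"
    by (metis bcontfunE)
  have "\<pi> (t \<otimes> h) = \<pi> t" if "h \<in> H" for t h
    using that \<pi>_eq[of t "t \<otimes> h"] by (simp flip: m_assoc)
  then have "f \<in> fixed_algebra G H"
    by (simp add: fixed_algebra_iff f)
  moreover have "apply_bcontfun f s \<noteq> apply_bcontfun f \<one>"
    using u(2,3) by (simp add: f)
  ultimately show ?thesis by blast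
qed

lemma right_stabilizer_fixed_algebra:
  assumes "H \<in> closed_subgroups G"
  shows "right_stabilizer G (fixed_algebra G H) = H"
proof (intro equalityI subsetI)
  fix s
  assume s: "s \<in> right_stabilizer G (fixed_algebra G H)"
  \<comment> \<open>Evaluate the invariance at the unit; outside \<open>H\<close> this would
    contradict separation.\<close>
  have "apply_bcontfun f s = apply_bcontfun f \<one>" if "f \<in> fixed_algebra G H" for f
    using s that unfolding right_stabilizer_iff by (metis carrier_UNIV UNIV_I l_one)
  then show "s \<in> H"
    using fixed_algebra_separates[OF assms] by blast
qed (simp add: right_stabilizer_iff fixed_algebra_iff)

section \<open>Recovering an invariant algebra\<close>

lemma left_invariantD:
  assumes "left_invariant G X" "f \<in> X"
  shows "\<exists>g\<in>X. \<forall>t. apply_bcontfun g t = apply_bcontfun f (s \<otimes> t)"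
proof -
  have "left_translate G s (apply_bcontfun f) \<in> apply_bcontfun ` X"
    using assms unfolding left_invariant_def by simp
  then show ?thesis
    unfolding left_translate_def by (metis imageE)
qed

lemma fixed_algebra_right_stabilizer:
  assumes "X \<in> left_invariant_algebras G"
  shows "fixed_algebra G (right_stabilizer G X) = X"
proof (intro equalityI subsetI)
  fix f
  assume f: "f \<in> fixed_algebra G (right_stabilizer G X)"
  have X: "cstar_subalgebra X" "X \<noteq> {0}" "closedin strict_topology X" "left_invariant G X"
    using assms unfolding left_invariant_algebras_def by auto
  show "f \<in> X"
  proof (rule strict_Stone_Weierstrass[OF X(1,3)])
    fix t
    have "0 \<in> X"
      using X(1) by (simp add: cstar_subalgebra_def)
    then obtain g where "g \<in> X" "g \<noteq> 0"
      using X(2) by blast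
    then obtain a where "apply_bcontfun g a \<noteq> 0"
      by (metis bcontfun_eqI bc_zero_apply)
    \<comment> \<open>Left translation by \<open>a \<otimes> inv t\<close> carries the nonzero value
      at \<open>a\<close> to the given point \<open>t\<close>.\<close>
    moreover have "(a \<otimes> inv t) \<otimes> t = a"
      by (simp add: m_assoc)
    ultimately show "\<exists>g\<in>X. apply_bcontfun g t \<noteq> 0"
      using left_invariantD[OF X(4) \<open>g \<in> X\<close>, of "a \<otimes> inv t"] by metis
  next
    fix s t
    assume st: "\<And>g. g \<in> X \<Longrightarrow> apply_bcontfun g s = apply_bcontfun g t"
    have "inv s \<otimes> t \<in> right_stabilizer G X"
      unfolding right_stabilizer_iff
    proof (intro ballI allI)
      fix g r
      assume "g \<in> X"
      \<comment> \<open>This translate takes at \<open>s\<close> and \<open>t\<close> the values of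
        \<open>g\<close> at \<open>r\<close> and \<open>r \<otimes> inv s \<otimes> t\<close>, and
        as a member of \<open>X\<close> it does not separate \<open>s\<close> from
        \<open>t\<close>.\<close>
      then obtain h where h: "h \<in> X" "\<And>x. apply_bcontfun h x = apply_bcontfun g ((r \<otimes> inv s) \<otimes> x)"
        using left_invariantD[OF X(4)] by meson
      show "apply_bcontfun g (r \<otimes> (inv s \<otimes> t)) = apply_bcontfun g r"
        using st[OF h(1)] by (simp add: h(2) m_assoc)
    qed
    then have "apply_bcontfun f (s \<otimes> (inv s \<otimes> t)) = apply_bcontfun f s"
      using f unfolding fixed_algebra_iff by blast
    then show "apply_bcontfun f s = apply_bcontfun f t"
      by (simp flip: m_assoc)
  qed
qed (simp add: right_stabilizer_iff fixed_algebra_iff)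

section \<open>Normality and right invariance\<close>

lemma normal_iff_right_invariant:
  assumes H: "H \<in> closed_subgroups G"
  shows "H \<lhd> G \<longleftrightarrow> right_invariant G (fixed_algebra G H)"
proof
  assume N: "H \<lhd> G"
  show "right_invariant G (fixed_algebra G H)"
    unfolding right_invariant_def
  proof (intro ballI)
    fix f s
    assume f: "f \<in> fixed_algebra G H"
    obtain g where g: "apply_bcontfun g = right_translate G s (apply_bcontfun f)"
      using right_translate_bcontfun by blast
    have "apply_bcontfun f (t \<otimes> h \<otimes> s) = apply_bcontfun f (t \<otimes> s)" if "h \<in> H" for t h
    proof -
      \<comment> \<open>Moving \<open>h\<close> past \<open>s\<close> replaces it by a conjugate,
        which normality keeps in \<open>H\<close>.\<close>
      have "inv s \<otimes> h \<otimes> s \<in> H"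
        using normal.inv_op_closed1[OF N, of s h] that by simp
      then have "apply_bcontfun f ((t \<otimes> s) \<otimes> (inv s \<otimes> h \<otimes> s)) = apply_bcontfun f (t \<otimes> s)"
        using f unfolding fixed_algebra_iff by blast
      moreover have "(t \<otimes> s) \<otimes> (inv s \<otimes> h \<otimes> s) = t \<otimes> h \<otimes> s"
        by (simp add: m_assoc mult_inv_cancel)
      ultimately show ?thesis by simp
    qed
    then have "g \<in> fixed_algebra G H"
      by (simp add: fixed_algebra_iff g right_translate_def)
    then show "right_translate G s (apply_bcontfun f) \<in> apply_bcontfun ` fixed_algebra G H"
      using g by (metis imageI)
  qed
next
  assume R: "right_invariant G (fixed_algebra G H)"
  \<comment> \<open>As \<open>H\<close> is the stabilizer of its fixed algebra, a conjugate lies in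
    \<open>H\<close> once it stabilizes that algebra.\<close>
  have "x \<otimes> h \<otimes> inv x \<in> right_stabilizer G (fixed_algebra G H)" if "h \<in> H" for x h
    unfolding right_stabilizer_iff
  proof (intro ballI allI)
    fix f t
    assume "f \<in> fixed_algebra G H"
    \<comment> \<open>With \<open>g\<close> the right translate of \<open>f\<close> by
      \<open>inv x\<close>, the values of \<open>f\<close> at \<open>t\<close> and
      \<open>t \<otimes> x \<otimes> h \<otimes> inv x\<close> are those of \<open>g\<close> at
      \<open>t \<otimes> x\<close> and \<open>t \<otimes> x \<otimes> h\<close>.\<close>
    then obtain g where g: "g \<in> fixed_algebra G H" "right_translate G (inv x) (apply_bcontfun f) = apply_bcontfun g"
      using R unfolding right_invariant_def by auto
    have "apply_bcontfun g (t \<otimes> x \<otimes> h) = apply_bcontfun g (t \<otimes> x)"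
      using g(1) that unfolding fixed_algebra_iff by blast
    then show "apply_bcontfun f (t \<otimes> (x \<otimes> h \<otimes> inv x)) = apply_bcontfun f t"
      by (simp add: right_translate_def m_assoc flip: g(2))
  qed
  then show "H \<lhd> G"
    using H by (auto simp: normal_inv_iff right_stabilizer_fixed_algebra[OF H] closed_subgroups_def)
qed

end

theorem theorem1:
  fixes G :: "('a::t2_space, 'b) monoid_scheme"
  assumes "locally_compact_group G"
  shows "(\<forall>H \<in> closed_subgroups G. fixed_algebra G H \<in> left_invariant_algebras G) \<and>
    (\<forall>X \<in> left_invariant_algebras G. right_stabilizer G X \<in> closed_subgroups G) \<and>
    (\<forall>H \<in> closed_subgroups G. right_stabilizer G (fixed_algebra G H) = H) \<and>
    (\<forall>X \<in> left_invariant_algebras G. fixed_algebra G (right_stabilizer G X) = X) \<and>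
    (\<forall>H \<in> closed_subgroups G. H \<lhd> G \<longleftrightarrow> right_invariant G (fixed_algebra G H))"
proof -
  interpret locally_compact_group G by fact
  have "H \<noteq> {}" if "H \<in> closed_subgroups G" for H
    using that subgroup.one_closed unfolding closed_subgroups_def by blast
  then show ?thesis
    by (intro conjI ballI fixed_algebra_mem_left_invariant_algebras
        right_stabilizer_mem_closed_subgroups right_stabilizer_fixed_algebra
        fixed_algebra_right_stabilizer normal_iff_right_invariant)
qed

end
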